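(* Let $\alpha$ be a simple root of $f(x)$, and suppose that $f(x)$ is sufficiently smooth around $\alpha$. Suppose that the initial guess $x_0$ is sufficiently close to $\alpha$. Then the iterative method defined by $$x_{n+1} = x_n - C_*(L_f(x_n))\,\frac{f(x_n)}{f'(x_n)}$$ has at least third-order convergence and satisfies the error equation $$e_{n+1} = (c_2^2 - c_3)\, e_n^3 + O(e_n^4),$$ where $e_n = x_n - \alpha$ denotes the error at the $n$th iteration and $$c_j = \frac{f^{(j)}(\alpha)}{j!\, f'(\alpha)}, \qquad j = 2, 3.$$
   Context: The method is a one-point iterative method for solving a nonlinear equation $f(x) = 0$ in one real variable. Here $$L_f(x) = \frac{f(x) f''(x)}{f'(x)^2},$$ and the correction function $C_*$ is given by $$C_*(L_f(x)) = \frac{2}{1 + \dfrac{1 - L_f(x) + \frac{1}{2}L_f(x)^2}{1 - L_f(x) + L_f(x)^2}\left(\sqrt{1 + L_f(x)^2} - L_f(x)\right)}.$$ *)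

theory Defs
  imports "HOL-Analysis.Analysis" "HOL-Library.Landau_Symbols"
begin

text \<open>For open \<open>S\<close> this is the class \<open>C\<^sup>k(S)\<close>; continuity of the derivatives
  of order below \<open>k\<close> is implied by their differentiability.\<close>

definition Ck_on :: "nat \<Rightarrow> (real \<Rightarrow> real) \<Rightarrow> real set \<Rightarrow> bool" where
  "Ck_on k f S \<longleftrightarrow>
     (\<forall>j<k. \<forall>x\<in>S. (deriv ^^ j) f differentiable (at x)) \<and>
     continuous_on S ((deriv ^^ k) f)"

definition simple_root :: "(real \<Rightarrow> real) \<Rightarrow> real \<Rightarrow> bool" where
  "simple_root f \<alpha> \<longleftrightarrow> f differentiable (at \<alpha>) \<and> f \<alpha> = 0 \<and> deriv f \<alpha> \<noteq> 0"

definition L :: "(real \<Rightarrow> real) \<Rightarrow> real \<Rightarrow> real" where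
  "L f x = f x * (deriv ^^ 2) f x / (deriv f x)\<^sup>2"

text \<open>Both denominators are positive for every real \<open>t\<close>.\<close>

definition C_star :: "real \<Rightarrow> real" where
  "C_star t = 2 / (1 + (1 - t + 1/2 * t\<^sup>2) / (1 - t + t\<^sup>2) * (sqrt (1 + t\<^sup>2) - t))"

definition method_step :: "(real \<Rightarrow> real) \<Rightarrow> real \<Rightarrow> real" where
  "method_step f x = x - C_star (L f x) * (f x / deriv f x)"

definition err_coeff :: "(real \<Rightarrow> real) \<Rightarrow> real \<Rightarrow> nat \<Rightarrow> real" where
  "err_coeff f \<alpha> j = (deriv ^^ j) f \<alpha> / (fact j * deriv f \<alpha>)"

text \<open>Meant for \<open>p \<ge> 2\<close>; order one would also require an asymptotic constant below one.\<close>

definition converges_with_order_at_least :: "nat \<Rightarrow> (nat \<Rightarrow> real) \<Rightarrow> real \<Rightarrow> bool" where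
  "converges_with_order_at_least p x \<alpha> \<longleftrightarrow>
     x \<longlonglongrightarrow> \<alpha> \<and> (\<lambda>n. x (Suc n) - \<alpha>) \<in> O(\<lambda>n. (x n - \<alpha>) ^ p)"

end

theory Submission
  imports Defs "HOL-Real_Asymp.Real_Asymp"
begin

text \<open>
  Up to order three, \<open>C_star t\<close> agrees with Halley's correction factor \<open>2 / (2 - t)\<close>: one has
  \<open>C_star t = 2 / (2 - t + t\<^sup>3 s(t))\<close> with \<open>s\<close> bounded near \<open>0\<close>. Substituting the Taylor expansions of
  \<open>f\<close>, \<open>f'\<close> and \<open>f''\<close> at \<open>\<alpha>\<close>, with the quotients of their remainders by powers of \<open>e = x - \<alpha>\<close> kept
  as bounded functions, the error of one step becomes an exact rational expression whose \<open>e\<^sup>3\<close> coefficient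
  is \<open>c2\<^sup>2 - c3\<close>. Near \<open>\<alpha>\<close> the resulting cubic bound makes one step at least halve the error, so the
  iteration stays in the neighbourhood and the local estimate applies at every step.
\<close>

text \<open>Near 0 the rational factor is 1 - t^2/2 + O(t^3) and sqrt (1 + t^2) - t is 1 - t + t^2/2
  + O(t^4), so the quadratic terms of the product cancel and leave 1 - t + O(t^3). Solving for the
  remainder makes the identity hold for every \<open>t\<close>; only the bound on \<open>s\<close>
  is local.\<close>

lemma C_star_halley_form:
  obtains s :: "real \<Rightarrow> real"
  where "s \<in> O[nhds 0](\<lambda>_. 1)" and "\<And>t. C_star t = 2 / (2 - t + t ^ 3 * s t)"
proof
  let ?A = "\<lambda>t::real. (1 - t + 1/2 * t\<^sup>2) / (1 - t + t\<^sup>2) * (sqrt (1 + t\<^sup>2) - t)"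
  let ?s = "\<lambda>t. (?A t - 1 + t) / t ^ 3"
  have "?s \<in> O[at 0](\<lambda>_. 1)"
    by real_asymp
  then obtain c where "\<forall>\<^sub>F t in at 0. norm (?s t) \<le> c * norm (1::real)"
    by (elim landau_o.bigE)
  \<comment> \<open>Division by zero gives \<open>?s 0 = 0\<close>, so a nonnegative constant
    carries the bound over to the point 0 itself.\<close>
  then have "\<forall>\<^sub>F t in at 0. norm (?s t) \<le> max c 0 * norm (1::real)"
    by eventually_elim auto
  then have "\<forall>\<^sub>F t in nhds 0. norm (?s t) \<le> max c 0 * norm (1::real)"
    by (simp add: eventually_nhds_conv_at)
  then show "?s \<in> O[nhds 0](\<lambda>_. 1)"
    by (rule bigoI)
  show "C_star t = 2 / (2 - t + t ^ 3 * ?s t)" for t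
  proof (cases "t = 0")
    case False
    then have "2 - t + t ^ 3 * ?s t = 1 + ?A t" by simp
    then show ?thesis by (simp only: C_star_def)
  qed (simp add: C_star_def)
qed

text \<open>Lagrange's remainder, with the \<open>n\<close>-th derivative bounded on a compact ball
  around \<alpha>. Taking \<rho> to be the exact quotient turns the expansion into an equation for
  every \<open>x\<close>, fit for algebraic rewriting; only the bound is local.\<close>

lemma taylor_remainder_bounded:
  fixes f :: "real \<Rightarrow> real"
  assumes "open S" and "\<alpha> \<in> S" and f: "Ck_on n f S" and "i < n"
  obtains \<rho> where "\<rho> \<in> O[nhds \<alpha>](\<lambda>_. 1)"
    and "\<And>x. (deriv ^^ i) f x =
      (\<Sum>m<n - i. (deriv ^^ (m + i)) f \<alpha> / fact m * (x - \<alpha>) ^ m) + \<rho> x * (x - \<alpha>) ^ (n - i)"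
proof -
  let ?T = "\<lambda>x. \<Sum>m<n - i. (deriv ^^ (m + i)) f \<alpha> / fact m * (x - \<alpha>) ^ m"
  define \<rho> where "\<rho> x = ((deriv ^^ i) f x - ?T x) / (x - \<alpha>) ^ (n - i)" for x
  obtain d where d: "d > 0" "cball \<alpha> d \<subseteq> S"
    using assms(1,2) open_contains_cball by metis
  have cont: "continuous_on (cball \<alpha> d) ((deriv ^^ n) f)"
    using f d(2) unfolding Ck_on_def by (meson continuous_on_subset)
  then have "bounded ((deriv ^^ n) f ` cball \<alpha> d)"
    by (intro compact_imp_bounded compact_continuous_image) auto
  then obtain B where "\<forall>y\<in>(deriv ^^ n) f ` cball \<alpha> d. norm y \<le> B"
    unfolding bounded_iff by blast
  then have B: "\<bar>(deriv ^^ n) f t\<bar> \<le> B" if "t \<in> cball \<alpha> d" for t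
    using that by auto
  have "B \<ge> 0" using B[of \<alpha>] d(1) by auto
  have der: "((deriv ^^ (m + i)) f has_real_derivative (deriv ^^ (Suc m + i)) f t) (at t)"
    if "m < n - i" "t \<in> S" for m t
  proof -
    have "(deriv ^^ (m + i)) f differentiable at t"
      using f that unfolding Ck_on_def by auto
    then show ?thesis
      by (simp add: DERIV_deriv_iff_real_differentiable)
  qed
  have bound: "\<bar>\<rho> x\<bar> \<le> B" if x: "x \<in> cball \<alpha> d" for x
  proof (cases "x = \<alpha>")
    case True
    then show ?thesis using \<open>i < n\<close> \<open>B \<ge> 0\<close> by (simp add: \<rho>_def)
  next
    case False
    have sub: "t \<in> cball \<alpha> d \<longleftrightarrow> \<alpha> - d \<le> t \<and> t \<le> \<alpha> + d" for t
      by (auto simp: dist_real_def)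
    have "\<exists>t. (if x < \<alpha> then x < t \<and> t < \<alpha> else \<alpha> < t \<and> t < x) \<and>
        (deriv ^^ i) f x = (\<Sum>m<n - i. (deriv ^^ (m + i)) f \<alpha> / fact m * (x - \<alpha>) ^ m)
          + (deriv ^^ (n - i + i)) f t / fact (n - i) * (x - \<alpha>) ^ (n - i)"
    proof (rule Taylor[where a = "\<alpha> - d" and b = "\<alpha> + d"])
      show "\<forall>m t. m < n - i \<and> \<alpha> - d \<le> t \<and> t \<le> \<alpha> + d \<longrightarrow>
          ((deriv ^^ (m + i)) f has_real_derivative (deriv ^^ (Suc m + i)) f t) (at t)"
        using der d(2) sub by blast
    qed (use False x sub \<open>i < n\<close> d(1) in auto)
    then obtain t where t: "if x < \<alpha> then x < t \<and> t < \<alpha> else \<alpha> < t \<and> t < x"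
      and "(deriv ^^ i) f x = ?T x + (deriv ^^ n) f t / fact (n - i) * (x - \<alpha>) ^ (n - i)"
      using \<open>i < n\<close> by auto
    then have "\<rho> x = (deriv ^^ n) f t / fact (n - i)"
      using False by (simp add: \<rho>_def)
    moreover have "t \<in> cball \<alpha> d"
      using t x d(1) unfolding sub by (auto split: if_splits)
    then have "\<bar>(deriv ^^ n) f t\<bar> / fact (n - i) \<le> B / 1"
      using \<open>B \<ge> 0\<close> by (intro frac_le B) auto
    ultimately show ?thesis by simp
  qed
  have "\<forall>\<^sub>F x in nhds \<alpha>. x \<in> ball \<alpha> d"
    using d(1) by (intro eventually_nhds_in_open) auto
  then have "\<forall>\<^sub>F x in nhds \<alpha>. norm (\<rho> x) \<le> B * norm (1::real)"
    by eventually_elim (use bound in auto)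
  then have "\<rho> \<in> O[nhds \<alpha>](\<lambda>_. 1)"
    by (rule bigoI)
  \<comment> \<open>At \<open>x = \<alpha>\<close> the remainder term vanishes and the sum reduces
    to its term \<open>m = 0\<close>, where 0^0 = 1.\<close>
  moreover have "(deriv ^^ i) f x = ?T x + \<rho> x * (x - \<alpha>) ^ (n - i)" for x
    using \<open>i < n\<close> by (cases "x = \<alpha>") (auto simp: \<rho>_def lessThan_Suc_eq_insert_0 sum.atLeast_Suc_lessThan
        simp flip: atLeast0LessThan)
  ultimately show ?thesis ..
qed

text \<open>Read \<open>e\<close> as x - \<alpha>, \<open>l\<close> as L_f(x)/e, and
  \<open>u\<close>, \<open>v\<close>, \<open>w\<close> as f/(a e), f'/a, f''/a with a =
  f'(\<alpha>). Over the denominator 2 + e Q the numerator is e times 2 v (v - u) - e u w plus a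
  term in e^3. Here 2 v (v - u) starts with 2 c2 e + (4 c2^2 + 4 c3) e^2 and e u w with 2 c2 e + (2
  c2^2 + 6 c3) e^2, so 2 (c2^2 - c3) e^2 is left. \<open>P\<close> collects everything from e^3 on,
  including the contribution of \<open>s\<close>.\<close>

lemma halley_numerator:
  fixes e :: real
  assumes "v \<noteq> 0" and D: "(2 - e * l + (e * l) ^ 3 * s) * v\<^sup>2 = 2 + e * Q" "2 + e * Q \<noteq> 0"
    and u: "u = 1 + c2 * e + (c3 + \<rho>0 * e) * e\<^sup>2"
    and v: "v = 1 + 2 * c2 * e + (3 * c3 + \<rho>1 * e) * e\<^sup>2"
    and w: "w = 2 * c2 + 6 * c3 * e + \<rho>2 * e\<^sup>2"
    and l: "l * v\<^sup>2 = u * w"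
    and P: "P = 2 * ((3 * c3 + \<rho>1 * e) * (c2 + 2 * c3 * e + (\<rho>1 - \<rho>0) * e\<^sup>2)
        + (1 + 2 * c2 * e) * (\<rho>1 - \<rho>0) + 4 * c2 * c3)
      - ((c3 + \<rho>0 * e) * w + (1 + c2 * e) * \<rho>2 + 6 * c2 * c3) + l ^ 3 * s * v\<^sup>2"
  shows "e - 2 / (2 - e * l + (e * l) ^ 3 * s) * (e * u / v) - (c2\<^sup>2 - c3) * e ^ 3
    = (P - (c2\<^sup>2 - c3) * Q) / (2 + e * Q) * e ^ 4"
proof -
  let ?d = "2 - e * l + (e * l) ^ 3 * s"
  have d0: "?d \<noteq> 0" using D by auto
  have num: "?d * v\<^sup>2 - 2 * u * v = e * (2 * (c2\<^sup>2 - c3) * e + e\<^sup>2 * P)"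
  proof -
    \<comment> \<open>Outside the cubic term, \<open>l\<close> is grouped as
      \<open>l * v\<^sup>2\<close>, which \<open>u * w\<close> can replace; what remains is a
      polynomial identity.\<close>
    have "?d * v\<^sup>2 - 2 * u * v = 2 * v * (v - u) - e * (l * v\<^sup>2) + e ^ 3 * (l ^ 3 * s * v\<^sup>2)"
      by algebra
    also have "\<dots> = 2 * v * (v - u) - e * (u * w) + e ^ 3 * (l ^ 3 * s * v\<^sup>2)"
      by (simp add: l)
    also have "\<dots> = e * (2 * (c2\<^sup>2 - c3) * e + e\<^sup>2 * P)"
      unfolding P u v w by algebra
    finally show ?thesis .
  qed
  have "e - 2 / ?d * (e * u / v) = e * (?d * v\<^sup>2 - 2 * u * v) / (?d * v\<^sup>2)"
    using d0 \<open>v \<noteq> 0\<close> by (simp add: divide_simps power2_eq_square) algebra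
  also have "\<dots> = e * (e * (2 * (c2\<^sup>2 - c3) * e + e\<^sup>2 * P)) / (2 + e * Q)"
    unfolding num unfolding D(1) ..
  finally have "e - 2 / ?d * (e * u / v) - (c2\<^sup>2 - c3) * e ^ 3
      = (e * (e * (2 * (c2\<^sup>2 - c3) * e + e\<^sup>2 * P)) - (c2\<^sup>2 - c3) * e ^ 3 * (2 + e * Q)) / (2 + e * Q)"
    by (simp only: divide_diff_eq_iff[OF D(2)])
  also have "e * (e * (2 * (c2\<^sup>2 - c3) * e + e\<^sup>2 * P)) - (c2\<^sup>2 - c3) * e ^ 3 * (2 + e * Q)
      = (P - (c2\<^sup>2 - c3) * Q) * e ^ 4"
    by algebra
  finally show ?thesis by simp
qed

text \<open>The local bound makes \<open>g\<close> contract towards \<alpha> on a small interval, so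
  no iterate leaves it and the estimates hold for all \<open>n\<close>. \<open>Q\<close> stands for
  any property that holds near \<alpha> and is to be inherited by every iterate.\<close>

lemma fixed_point_iteration_cubic_error:
  fixes g :: "real \<Rightarrow> real"
  assumes err: "\<forall>\<^sub>F y in nhds \<alpha>. \<bar>g y - \<alpha> - \<kappa> * (y - \<alpha>) ^ 3\<bar> \<le> K * \<bar>y - \<alpha>\<bar> ^ 4"
    and Q: "\<forall>\<^sub>F y in nhds \<alpha>. Q y"
  shows "\<exists>\<delta>>0. \<forall>x :: nat \<Rightarrow> real. \<bar>x 0 - \<alpha>\<bar> < \<delta> \<longrightarrow> (\<forall>n. x (Suc n) = g (x n)) \<longrightarrow>
      (\<forall>n. Q (x n)) \<and> converges_with_order_at_least 3 x \<alpha> \<and>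
      (\<forall>n. \<bar>x (Suc n) - \<alpha> - \<kappa> * (x n - \<alpha>) ^ 3\<bar> \<le> K * \<bar>x n - \<alpha>\<bar> ^ 4)"
proof -
  \<comment> \<open>For errors of size at most 1 the fourth power is below the cube, so the absolute
    values of \<kappa> and \<open>K\<close> add up to a cubic constant. The summand 1 keeps
    \<open>M\<close> away from 0.\<close>
  define M where "M = \<bar>\<kappa>\<bar> + \<bar>K\<bar> + 1"
  have "M \<ge> 1" by (simp add: M_def)
  obtain d where "d > 0" and d: "\<And>y. \<bar>y - \<alpha>\<bar> < d \<Longrightarrow>
      Q y \<and> \<bar>g y - \<alpha> - \<kappa> * (y - \<alpha>) ^ 3\<bar> \<le> K * \<bar>y - \<alpha>\<bar> ^ 4"
    using eventually_conj[OF Q err] unfolding eventually_nhds_metric dist_real_def by blast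
  \<comment> \<open>The second bound serves twice: it gives \<delta> \<le> 1, and it makes M
    \<delta> \<le> 1/2, which yields the halving.\<close>
  define \<delta> where "\<delta> = min d (1 / (2 * M))"
  have "\<delta> > 0" "\<delta> \<le> d" "M * \<delta> \<le> 1 / 2"
    using \<open>d > 0\<close> \<open>M \<ge> 1\<close> by (auto simp: \<delta>_def min_def field_simps)
  moreover have "\<delta> \<le> 1 / (2 * M)" by (simp add: \<delta>_def)
  moreover have "1 / (2 * M) \<le> 1" using \<open>M \<ge> 1\<close> by (simp add: field_simps)
  ultimately have \<delta>: "\<delta> > 0" "\<delta> \<le> d" "\<delta> \<le> 1" "M * \<delta> \<le> 1 / 2" by auto
  have cubic: "\<bar>g y - \<alpha>\<bar> \<le> M * \<bar>y - \<alpha>\<bar> ^ 3" if y: "\<bar>y - \<alpha>\<bar> < \<delta>" for y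
  proof -
    have "\<bar>g y - \<alpha>\<bar> \<le> \<bar>g y - \<alpha> - \<kappa> * (y - \<alpha>) ^ 3\<bar> + \<bar>\<kappa> * (y - \<alpha>) ^ 3\<bar>"
      by linarith
    also have "\<dots> \<le> K * \<bar>y - \<alpha>\<bar> ^ 4 + \<bar>\<kappa>\<bar> * \<bar>y - \<alpha>\<bar> ^ 3"
      using d[of y] y \<delta> by (simp add: abs_mult power_abs)
    also have "K * \<bar>y - \<alpha>\<bar> ^ 4 \<le> \<bar>K\<bar> * \<bar>y - \<alpha>\<bar> ^ 3"
      using y \<delta> by (intro mult_mono power_decreasing) auto
    also have "\<bar>K\<bar> * \<bar>y - \<alpha>\<bar> ^ 3 + \<bar>\<kappa>\<bar> * \<bar>y - \<alpha>\<bar> ^ 3 \<le> M * \<bar>y - \<alpha>\<bar> ^ 3"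
      by (simp add: M_def algebra_simps)
    finally show ?thesis by simp
  qed
  have half: "\<bar>g y - \<alpha>\<bar> \<le> \<bar>y - \<alpha>\<bar> / 2" if y: "\<bar>y - \<alpha>\<bar> < \<delta>" for y
  proof -
    have "M * \<bar>y - \<alpha>\<bar> ^ 3 = M * \<bar>y - \<alpha>\<bar> * \<bar>y - \<alpha>\<bar> * \<bar>y - \<alpha>\<bar>"
      by (simp add: power3_eq_cube)
    also have "\<dots> \<le> M * \<delta> * 1 * \<bar>y - \<alpha>\<bar>"
      using y \<delta> \<open>M \<ge> 1\<close> by (intro mult_mono) auto
    also have "\<dots> \<le> 1 / 2 * \<bar>y - \<alpha>\<bar>"
      using \<delta>(4) by (intro mult_right_mono) auto
    finally show ?thesis using cubic[OF y] by simp
  qed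
  show ?thesis
  proof (intro exI[of _ \<delta>] conjI allI impI)
    show "\<delta> > 0" by fact
    fix x :: "nat \<Rightarrow> real"
    assume x0: "\<bar>x 0 - \<alpha>\<bar> < \<delta>" and step: "\<forall>n. x (Suc n) = g (x n)"
    \<comment> \<open>Needed already inside the induction for \<open>geom\<close>: the bound at
      \<open>n\<close> must place \<open>x n\<close> within \<delta> before \<open>half\<close>
      applies.\<close>
    have pow: "\<bar>x 0 - \<alpha>\<bar> * (1 / 2) ^ n \<le> \<bar>x 0 - \<alpha>\<bar>" for n
      by (simp add: mult_left_le power_le_one)
    have geom: "\<bar>x n - \<alpha>\<bar> \<le> \<bar>x 0 - \<alpha>\<bar> * (1 / 2) ^ n" for n
    proof (induction n)
      case (Suc n)
      have "\<bar>x n - \<alpha>\<bar> < \<delta>"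
        using order_trans[OF Suc pow] x0 by (rule order_le_less_trans)
      then show ?case using half[of "x n"] step Suc by simp
    qed simp
    have near: "\<bar>x n - \<alpha>\<bar> < \<delta>" for n
      using order_trans[OF geom pow] x0 by (rule order_le_less_trans)
    have "(\<lambda>n. x n - \<alpha>) \<longlonglongrightarrow> 0"
    proof (rule Lim_null_comparison)
      show "\<forall>\<^sub>F n in sequentially. norm (x n - \<alpha>) \<le> \<bar>x 0 - \<alpha>\<bar> * (1 / 2) ^ n"
        using geom by simp
      show "(\<lambda>n. \<bar>x 0 - \<alpha>\<bar> * (1 / 2) ^ n) \<longlonglongrightarrow> 0"
        by (intro tendsto_mult_right_zero LIMSEQ_power_zero) auto
    qed
    then have "x \<longlonglongrightarrow> \<alpha>" by (rule LIM_zero_cancel)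
    moreover have "(\<lambda>n. x (Suc n) - \<alpha>) \<in> O(\<lambda>n. (x n - \<alpha>) ^ 3)"
      using cubic near step by (intro bigoI[of _ M]) (simp add: power_abs)
    ultimately show "converges_with_order_at_least 3 x \<alpha>"
      by (simp add: converges_with_order_at_least_def)
    show "Q (x n)" for n
      using d near \<delta>(2) by (meson order_less_le_trans)
    show "\<bar>x (Suc n) - \<alpha> - \<kappa> * (x n - \<alpha>) ^ 3\<bar> \<le> K * \<bar>x n - \<alpha>\<bar> ^ 4" for n
      using d near \<delta>(2) step by (metis order_less_le_trans)
  qed
qed

lemma bounded_mult:
  fixes f g :: "'a \<Rightarrow> real"
  shows "f \<in> O[F](\<lambda>_. 1) \<Longrightarrow> g \<in> O[F](\<lambda>_. 1) \<Longrightarrow> (\<lambda>x. f x * g x) \<in> O[F](\<lambda>_. 1)"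
  using landau_o.big_mult[of f F "\<lambda>_. 1" g "\<lambda>_. 1"] by simp

lemma bounded_power:
  fixes f :: "'a \<Rightarrow> real"
  shows "f \<in> O[F](\<lambda>_. 1) \<Longrightarrow> (\<lambda>x. f x ^ n) \<in> O[F](\<lambda>_. 1)"
  using landau_o.big_power[of f F "\<lambda>_. 1" n] by simp

text \<open>Gives the limits of \<open>1 + e * v1\<close>, \<open>2 + e * Q\<close> and
  \<open>e * l\<close> from the mere boundedness of their coefficients.\<close>

lemma tendsto_mult_bounded_zero:
  fixes f g :: "'a \<Rightarrow> real"
  assumes "(f \<longlongrightarrow> 0) F" and "g \<in> O[F](\<lambda>_. 1)"
  shows "((\<lambda>x. f x * g x) \<longlongrightarrow> 0) F"
proof -
  have "f \<in> o[F](\<lambda>_. 1)" using assms(1) by (intro smalloI_tendsto) auto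
  from landau_o.small_big_mult[OF this assms(2)] show ?thesis
    by (auto dest: smalloD_tendsto)
qed

text \<open>\<open>halley_numerator\<close> supplies an exact formula for the error, so the
  asymptotics amount to the boundedness of \<open>P\<close>, \<open>Q\<close> and the inverse of
  \<open>2 + e * Q\<close>. The filter is \<open>nhds\<close> rather than \<open>at\<close> because
  an iterate may hit \<alpha> exactly.\<close>

lemma method_step_error:
  fixes f :: "real \<Rightarrow> real"
  assumes S: "open S" "\<alpha> \<in> S" and f: "Ck_on 4 f S" and root: "simple_root f \<alpha>"
  shows "(\<lambda>x. method_step f x - \<alpha> - ((err_coeff f \<alpha> 2)\<^sup>2 - err_coeff f \<alpha> 3) * (x - \<alpha>) ^ 3)
      \<in> O[nhds \<alpha>](\<lambda>x. (x - \<alpha>) ^ 4)"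
    and "\<forall>\<^sub>F x in nhds \<alpha>. deriv f x \<noteq> 0"
proof -
  define a where "a = deriv f \<alpha>"
  define c2 where "c2 = err_coeff f \<alpha> 2"
  define c3 where "c3 = err_coeff f \<alpha> 3"
  have a: "a \<noteq> 0" and f0: "f \<alpha> = 0" using root by (auto simp: a_def simple_root_def)
  have d2: "(deriv ^^ 2) f \<alpha> = 2 * a * c2" and d3: "(deriv ^^ 3) f \<alpha> = 6 * a * c3"
    using a by (simp_all add: a_def c2_def c3_def err_coeff_def fact_numeral)
  have sums: "(\<Sum>m<4. g m) = g 0 + g 1 + g 2 + g 3" "(\<Sum>m<3. g m) = g 0 + g 1 + g 2"
    "(\<Sum>m<2. g m) = g 0 + g 1" for g :: "nat \<Rightarrow> real"
    by (simp_all add: eval_nat_numeral)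
  \<comment> \<open>The remainders of f, f', f'' have orders 4, 3, 2. Since f is divided by e and
    f'' enters with a factor e, all three first appear at e^3 in the numerator, that is, within
    \<open>P\<close>.\<close>
  obtain \<rho>0 where \<rho>0: "\<rho>0 \<in> O[nhds \<alpha>](\<lambda>_. 1)" and T0': "\<And>x. (deriv ^^ 0) f x =
      (\<Sum>m<4 - 0. (deriv ^^ (m + 0)) f \<alpha> / fact m * (x - \<alpha>) ^ m) + \<rho>0 x * (x - \<alpha>) ^ (4 - 0)"
    by (rule taylor_remainder_bounded[OF S f, of 0]) auto
  have T0: "f x = a * (x - \<alpha>) + a * c2 * (x - \<alpha>)\<^sup>2 + a * c3 * (x - \<alpha>) ^ 3 + \<rho>0 x * (x - \<alpha>) ^ 4" for x
    using T0'[of x] by (simp add: sums fact_numeral f0 d2 d3 flip: a_def)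
  obtain \<rho>1 where \<rho>1: "\<rho>1 \<in> O[nhds \<alpha>](\<lambda>_. 1)" and T1': "\<And>x. (deriv ^^ 1) f x =
      (\<Sum>m<4 - 1. (deriv ^^ (m + 1)) f \<alpha> / fact m * (x - \<alpha>) ^ m) + \<rho>1 x * (x - \<alpha>) ^ (4 - 1)"
    by (rule taylor_remainder_bounded[OF S f, of 1]) auto
  have T1: "deriv f x = a + 2 * a * c2 * (x - \<alpha>) + 3 * a * c3 * (x - \<alpha>)\<^sup>2 + \<rho>1 x * (x - \<alpha>) ^ 3" for x
    using T1'[of x] by (simp add: sums d2 d3 a_def del: funpow.simps flip: numeral_2_eq_2 numeral_3_eq_3)
      simp
  obtain \<rho>2 where \<rho>2: "\<rho>2 \<in> O[nhds \<alpha>](\<lambda>_. 1)" and T2': "\<And>x. (deriv ^^ 2) f x =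
      (\<Sum>m<4 - 2. (deriv ^^ (m + 2)) f \<alpha> / fact m * (x - \<alpha>) ^ m) + \<rho>2 x * (x - \<alpha>) ^ (4 - 2)"
    by (rule taylor_remainder_bounded[OF S f, of 2]) auto
  have T2: "(deriv ^^ 2) f x = 2 * a * c2 + 6 * a * c3 * (x - \<alpha>) + \<rho>2 x * (x - \<alpha>)\<^sup>2" for x
    using T2'[of x] by (simp add: sums d2 d3 del: funpow.simps flip: numeral_2_eq_2 numeral_3_eq_3)
  obtain s where s: "s \<in> O[nhds 0](\<lambda>_. 1)" "\<And>t. C_star t = 2 / (2 - t + t ^ 3 * s t)"
    by (rule C_star_halley_form) (rule that)
  \<comment> \<open>Scaling by \<open>a\<close> gives f = a e u, f' = a v, f'' = a w and L_f = e l,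
    so \<open>a\<close> cancels from both L_f and f/f'.\<close>
  define e where "e x = x - \<alpha>" for x
  define r0 where "r0 x = \<rho>0 x / a" for x
  define r1 where "r1 x = \<rho>1 x / a" for x
  define r2 where "r2 x = \<rho>2 x / a" for x
  define u where "u x = 1 + c2 * e x + (c3 + r0 x * e x) * (e x)\<^sup>2" for x
  define v where "v x = 1 + 2 * c2 * e x + (3 * c3 + r1 x * e x) * (e x)\<^sup>2" for x
  define w where "w x = 2 * c2 + 6 * c3 * e x + r2 x * (e x)\<^sup>2" for x
  define l where "l x = u x * w x * (inverse (v x))\<^sup>2" for x
  define \<sigma> where "\<sigma> x = s (L f x)" for x
  define P where "P x = 2 * ((3 * c3 + r1 x * e x) * (c2 + 2 * c3 * e x + (r1 x - r0 x) * (e x)\<^sup>2)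
        + (1 + 2 * c2 * e x) * (r1 x - r0 x) + 4 * c2 * c3)
      - ((c3 + r0 x * e x) * w x + (1 + c2 * e x) * r2 x + 6 * c2 * c3) + l x ^ 3 * \<sigma> x * (v x)\<^sup>2" for x
  \<comment> \<open>\<open>v1\<close> is (v - 1)/e written without division, so that
    \<open>Q\<close>, the quotient by e of the denominator minus 2, is visibly bounded at
    \<alpha>.\<close>
  define v1 where "v1 x = 2 * c2 + (3 * c3 + r1 x * e x) * e x" for x
  define Q where "Q x = (- l x + (e x)\<^sup>2 * l x ^ 3 * \<sigma> x) * (v x)\<^sup>2
      + 2 * (2 * v1 x + e x * (v1 x)\<^sup>2)" for x
  have feq: "f x = a * (e x * u x)" for x
    using a by (simp add: T0 u_def e_def r0_def field_simps) algebra
  have f'eq: "deriv f x = a * v x" for x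
    using a by (simp add: T1 v_def e_def r1_def field_simps) algebra
  have f''eq: "(deriv ^^ 2) f x = a * w x" for x
    using a by (simp add: T2 w_def e_def r2_def field_simps)
  \<comment> \<open>Where \<open>v x = 0\<close>, both sides are 0 by the convention for division,
    so the equation holds for every \<open>x\<close>.\<close>
  have Leq: "L f x = e x * l x" for x
    using a by (simp add: L_def feq f'eq f''eq l_def power2_eq_square field_simps)

  note bd = bounded_mult bounded_power sum_in_bigo bigo_const
  have e: "(e \<longlongrightarrow> 0) (nhds \<alpha>)"
    unfolding e_def by (rule tendsto_eq_intros filterlim_ident | simp)+
  have eb: "e \<in> O[nhds \<alpha>](\<lambda>_. 1)"
    using e by (intro bigoI_tendsto[of _ _ 0]) auto
  have rb: "r0 \<in> O[nhds \<alpha>](\<lambda>_. 1)" "r1 \<in> O[nhds \<alpha>](\<lambda>_. 1)" "r2 \<in> O[nhds \<alpha>](\<lambda>_. 1)"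
    using \<rho>0 \<rho>1 \<rho>2 a by (simp_all add: r0_def[abs_def] r1_def[abs_def] r2_def[abs_def])
  have ub: "u \<in> O[nhds \<alpha>](\<lambda>_. 1)" and vb: "v \<in> O[nhds \<alpha>](\<lambda>_. 1)" and wb: "w \<in> O[nhds \<alpha>](\<lambda>_. 1)"
    and v1b: "v1 \<in> O[nhds \<alpha>](\<lambda>_. 1)"
    unfolding u_def v_def w_def v1_def by (intro bd eb rb)+
  have "v = (\<lambda>x. 1 + e x * v1 x)"
    by (simp add: fun_eq_iff v_def v1_def power2_eq_square algebra_simps)
  moreover have "((\<lambda>x. 1 + e x * v1 x) \<longlongrightarrow> 1 + 0) (nhds \<alpha>)"
    by (intro tendsto_add tendsto_const tendsto_mult_bounded_zero e v1b)
  ultimately have v1eq: "v x = 1 + e x * v1 x" and vlim: "(v \<longlongrightarrow> 1) (nhds \<alpha>)" for x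
    by simp_all
  have v0: "\<forall>\<^sub>F x in nhds \<alpha>. v x \<noteq> 0"
    using vlim by (rule tendsto_imp_eventually_ne) simp
  then show "\<forall>\<^sub>F x in nhds \<alpha>. deriv f x \<noteq> 0"
    by eventually_elim (use a in \<open>simp add: f'eq\<close>)
  have ivb: "(\<lambda>x. inverse (v x)) \<in> O[nhds \<alpha>](\<lambda>_. 1)"
    using tendsto_inverse[OF vlim] by (intro bigoI_tendsto[of _ _ 1]) auto
  have lb: "l \<in> O[nhds \<alpha>](\<lambda>_. 1)"
    unfolding l_def by (intro bd ub wb ivb)
  \<comment> \<open>The function \<open>s\<close> is bounded only near 0, so bounding its
    composition with \<open>L f\<close> requires this limit.\<close>
  have "(L f \<longlongrightarrow> 0) (nhds \<alpha>)"
    using tendsto_mult_bounded_zero[OF e lb] by (simp add: Leq[abs_def])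
  then have \<sigma>b: "\<sigma> \<in> O[nhds \<alpha>](\<lambda>_. 1)"
    unfolding \<sigma>_def by (rule landau_o.big.compose[OF s(1)])
  have Pb: "P \<in> O[nhds \<alpha>](\<lambda>_. 1)" and Qb: "Q \<in> O[nhds \<alpha>](\<lambda>_. 1)"
    unfolding P_def Q_def by (intro bd landau_o.big.uminus eb rb ub vb wb lb v1b \<sigma>b | simp add: lb)+
  have "((\<lambda>x. 2 + e x * Q x) \<longlongrightarrow> 2 + 0) (nhds \<alpha>)"
    by (intro tendsto_add tendsto_const tendsto_mult_bounded_zero e Qb)
  then have D: "((\<lambda>x. 2 + e x * Q x) \<longlongrightarrow> 2) (nhds \<alpha>)" by simp
  have D0: "\<forall>\<^sub>F x in nhds \<alpha>. 2 + e x * Q x \<noteq> 0"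
    using D by (rule tendsto_imp_eventually_ne) simp
  have iDb: "(\<lambda>x. inverse (2 + e x * Q x)) \<in> O[nhds \<alpha>](\<lambda>_. 1)"
    using tendsto_inverse[OF D] by (intro bigoI_tendsto) auto

  have eq: "\<forall>\<^sub>F x in nhds \<alpha>. method_step f x - \<alpha> - (c2\<^sup>2 - c3) * (x - \<alpha>) ^ 3
    = (P x - (c2\<^sup>2 - c3) * Q x) * inverse (2 + e x * Q x) * e x ^ 4"
    using v0 D0
  proof eventually_elim
    case (elim x)
    have "method_step f x - \<alpha> = e x - 2 / (2 - e x * l x + (e x * l x) ^ 3 * \<sigma> x) * (e x * u x / v x)"
      using a by (simp add: method_step_def s(2) \<sigma>_def Leq feq f'eq e_def)
    moreover have "(2 - e x * l x + (e x * l x) ^ 3 * \<sigma> x) * (v x)\<^sup>2 = 2 + e x * Q x"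
    proof -
      have "(v x)\<^sup>2 = 1 + e x * (2 * v1 x + e x * (v1 x)\<^sup>2)"
        unfolding v1eq by algebra
      then show ?thesis unfolding Q_def by algebra
    qed
    moreover have "l x * (v x)\<^sup>2 = u x * w x"
      using elim(1) by (simp add: l_def field_simps)
    ultimately show ?case
      using halley_numerator[of "v x" "e x" "l x" "\<sigma> x" "Q x" "u x" c2 c3 "r0 x" "r1 x" "w x" "r2 x" "P x"]
        elim u_def v_def w_def P_def
      by (simp add: divide_inverse e_def)
  qed
  have "(\<lambda>x. (P x - (c2\<^sup>2 - c3) * Q x) * inverse (2 + e x * Q x) * e x ^ 4)
      \<in> O[nhds \<alpha>](\<lambda>x. 1 * e x ^ 4)"
    by (intro landau_o.big_mult[of _ _ "\<lambda>_. 1"] bd Pb Qb iDb) simp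
  then show "(\<lambda>x. method_step f x - \<alpha> - ((err_coeff f \<alpha> 2)\<^sup>2 - err_coeff f \<alpha> 3) * (x - \<alpha>) ^ 3)
      \<in> O[nhds \<alpha>](\<lambda>x. (x - \<alpha>) ^ 4)"
    unfolding c2_def[symmetric] c3_def[symmetric] landau_o.big.in_cong[OF eq] by (simp add: e_def)
qed

theorem theorem3p4:
  fixes f :: "real \<Rightarrow> real" and \<alpha> :: real and S :: "real set"
  assumes "open S" and "\<alpha> \<in> S" and "Ck_on 4 f S"
    and "simple_root f \<alpha>"
  shows "\<exists>\<delta>>0. \<exists>K. \<forall>x :: nat \<Rightarrow> real.
    \<bar>x 0 - \<alpha>\<bar> < \<delta> \<longrightarrow> (\<forall>n. x (Suc n) = method_step f (x n)) \<longrightarrow>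
      (\<forall>n. x n \<in> S \<and> deriv f (x n) \<noteq> 0) \<and>
      converges_with_order_at_least 3 x \<alpha> \<and>
      (\<forall>n. \<bar>(x (Suc n) - \<alpha>)
              - ((err_coeff f \<alpha> 2)\<^sup>2 - err_coeff f \<alpha> 3) * (x n - \<alpha>) ^ 3\<bar>
            \<le> K * \<bar>x n - \<alpha>\<bar> ^ 4)"
proof -
  obtain K where "\<forall>\<^sub>F x in nhds \<alpha>.
      \<bar>method_step f x - \<alpha> - ((err_coeff f \<alpha> 2)\<^sup>2 - err_coeff f \<alpha> 3) * (x - \<alpha>) ^ 3\<bar>
        \<le> K * \<bar>x - \<alpha>\<bar> ^ 4"
    using landau_o.bigE[OF method_step_error(1)[OF assms]] by (auto simp: power_abs)
  \<comment> \<open>This conjunction is the property inherited by all iterates; openness of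
    \<open>S\<close> provides its first half near \<alpha>.\<close>
  moreover have "\<forall>\<^sub>F x in nhds \<alpha>. x \<in> S \<and> deriv f x \<noteq> 0"
    using eventually_nhds_in_open[OF assms(1,2)] method_step_error(2)[OF assms]
    by (rule eventually_conj)
  ultimately show ?thesis
    using fixed_point_iteration_cubic_error[where Q = "\<lambda>x. x \<in> S \<and> deriv f x \<noteq> 0"] by blast
qed

end
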